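(* Let $\kappa \in \mathbb{Z}_p$. Then the kernel $H^0_\kappa(S(b',\varepsilon)) := \ker(\partial_\kappa : S(b',\varepsilon) \to S(b',\varepsilon))$ satisfies \[ H^0_\kappa(S(b',\varepsilon)) = \begin{cases} 0 & \text{if } \kappa \in \mathbb{Z}_p \setminus \{0\},\\ \Omega & \text{if } \kappa = 0.\end{cases} \]
   Context: Fix a prime $p \geq 5$, $\pi \in \overline{\mathbb{Q}}_p$ with $\pi^{p-1} = -p$, and $\Omega := \mathbb{Q}_p(\pi)$. Let $b, b'$ be real numbers with $(p-1)/p \geq b > 1/(p-1)$ and $b \geq b'$, and set $\varepsilon := b - 1/(p-1)$. For $\kappa \in \mathbb{Z}_p\setminus\mathbb{Z}_{\geq 0}$ and $m \geq 0$ let $\kappa^{\underline m} := \kappa(\kappa-1)\cdots(\kappa-m+1)$ ($\kappa^{\underline 0} := 1$). For $\kappa = k \in \mathbb{Z}_{\geq 0}$ let $k^{\underline 0} := 1$, $k^{\underline m} := k(k-1)\cdots(k-m+1)$ for $0 < m \leq k$, and for $m \geq k+1$ let $k^{\underline m}$ be the product of the $m$ consecutive factors $k, k-1, \dots, k-m+1$ with the factor $0$ omitted (e.g. $k^{\underline{k+1}} = k!$, $k^{\underline{k+2}} = -k!$, $0^{\underline 1} = 1$, $0^{\underline 2} = -1$). In $\Omega[[t,w]]$ put $w^{(m)} := \kappa^{\underline m} w^m$. For $\rho \in \mathbb{R}$ let $S(b',\varepsilon;\rho)$ be the set of series $\sum_{n,m\geq 0} A(n,m) t^n w^{(m)}$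 with $A(n,m) \in \Omega$ and $\mathrm{ord}_p A(n,m) \geq 2b'n + \varepsilon m + \rho$, and $S(b',\varepsilon) := \bigcup_\rho S(b',\varepsilon;\rho)$. The operator $\partial_\kappa$ on $S(b',\varepsilon)$ is defined on $t^n w^{(m)}$ and extended $\Omega$-linearly and termwise. For $\kappa \in \mathbb{Z}_p \setminus \mathbb{Z}_{\geq 0}$: $\partial_\kappa(t^n w^{(m)}) := n t^n w^{(m)} + t^n w^{(m+1)} + m(\kappa - m + 1)\pi^2 t^{n+1} w^{(m-1)}$ (the last term absent when $m=0$). For $\kappa = k \in \mathbb{Z}_{\geq 0}$: the same formula when $0 \leq m \leq k-1$ or $m \geq k+2$, while $\partial_k(t^n w^{(k)}) := n t^n w^{(k)} + k\pi^2 t^{n+1} w^{(k-1)}$ and $\partial_k(t^n w^{(k+1)}) := n t^n w^{(k+1)} + t^n w^{(k+2)} + (k+1)\pi^2 t^{n+1} w^{(k)}$ (terms with $w^{(-1)}$ are absent).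
   Formalization: The formal statement additionally assumes b' > 0 when κ is a positive integer; for b' ≤ 0 and κ = k ≥ 1 the claim fails (e.g. k = 1, A(n,1) = π^{2n}/(n!)², A(n,0) = -nA(n,1) gives a nonzero kernel element). All other κ are covered for every b' ≤ b. *)

theory Defs
  imports "HOL-Computational_Algebra.Computational_Algebra" "HOL-Library.Extended_Real"
begin

definition is_subfield :: "'a::field set \<Rightarrow> bool" where
  "is_subfield F \<longleftrightarrow> 0 \<in> F \<and> 1 \<in> F \<and>
     (\<forall>x\<in>F. \<forall>y\<in>F. x - y \<in> F \<and> x * y \<in> F) \<and> (\<forall>x\<in>F. inverse x \<in> F)"

definition adjoin :: "'a::field set \<Rightarrow> 'a \<Rightarrow> 'a set" where
  "adjoin K x = \<Inter> {F. is_subfield F \<and> K \<subseteq> F \<and> x \<in> F}"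

definition ord_Cauchy :: "('a::field \<Rightarrow> ereal) \<Rightarrow> (nat \<Rightarrow> 'a) \<Rightarrow> bool" where
  "ord_Cauchy ord X \<longleftrightarrow> (\<forall>C::real. \<exists>N. \<forall>i\<ge>N. \<forall>j\<ge>N. ord (X i - X j) \<ge> ereal C)"

definition ord_limit :: "('a::field \<Rightarrow> ereal) \<Rightarrow> (nat \<Rightarrow> 'a) \<Rightarrow> 'a \<Rightarrow> bool" where
  "ord_limit ord X x \<longleftrightarrow> (\<forall>C::real. \<exists>N. \<forall>i\<ge>N. ord (X i - x) \<ge> ereal C)"

text \<open>
  The closure of the rationals in the topology of \<open>ord\<close>. Inside an algebraic closure of
  $\mathbf{Q}_p$ this is $\mathbf{Q}_p$ itself, which is complete and hence closed.
\<close>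

definition padic_rationals :: "('a::field_char_0 \<Rightarrow> ereal) \<Rightarrow> 'a set" where
  "padic_rationals ord = {x. \<exists>X. (\<forall>i. X i \<in> \<rat>) \<and> ord_limit ord X x}"

definition padic_integers :: "('a::field_char_0 \<Rightarrow> ereal) \<Rightarrow> 'a set" where
  "padic_integers ord = {x \<in> padic_rationals ord. ord x \<ge> 0}"

text \<open>
  There is no type of $p$-adic numbers, so the type \<open>'a\<close> with the valuation \<open>ord\<close> is specified
  as an algebraic closure of the completion of the rationals at $p$, with the extension of the
  $p$-adic valuation that is normalised by \<open>ord p = 1\<close>. These conditions determine
  \<open>('a, ord)\<close> up to isomorphism. In particular \<open>ord\<close> restricts to the $p$-adic valuation of
  the rationals: integers have \<open>ord \<ge> 0\<close> by the ultrametric inequality, and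
  \<open>a * n + b * p = 1\<close> forces \<open>ord n = 0\<close>.
\<close>

locale padic_closure =
  fixes p :: nat and ord :: "'a::{alg_closed_field, field_char_0} \<Rightarrow> ereal"
  assumes prime_p: "prime p"
    and ord_eq_infinity_iff: "ord x = \<infinity> \<longleftrightarrow> x = 0"
    and ord_neq_minus_infinity: "ord x \<noteq> -\<infinity>"
    and ord_mult: "ord (x * y) = ord x + ord y"
    and ord_add: "ord (x + y) \<ge> min (ord x) (ord y)"
    and ord_p: "ord (of_nat p) = 1"
    and complete: "(\<And>i. X i \<in> padic_rationals ord) \<Longrightarrow> ord_Cauchy ord X \<Longrightarrow>
          \<exists>x \<in> padic_rationals ord. ord_limit ord X x"
    and algebraic: "\<exists>P. P \<noteq> 0 \<and> (\<forall>i. coeff P i \<in> padic_rationals ord) \<and> poly P x = 0"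

text \<open>
  The product of the factors $\kappa - j$, $0 \le j < m$, with a vanishing factor omitted;
  a factor vanishes only if $\kappa = k$ is a natural number and $m \ge k + 1$.
\<close>

definition mod_ffact :: "'a::field_char_0 \<Rightarrow> nat \<Rightarrow> 'a" where
  "mod_ffact \<kappa> m = (\<Prod>j | j < m \<and> \<kappa> \<noteq> of_nat j. \<kappa> - of_nat j)"

lemma mod_ffact_nonzero: "mod_ffact \<kappa> m \<noteq> 0"
  by (simp add: mod_ffact_def)

text \<open>
  A power series in $t$ and $w$ is an element of \<open>'a fps fps\<close>, where the outer variable is $t$:
  the coefficient of $t^n w^m$ in \<open>F\<close> is \<open>F $ n $ m\<close>.
\<close>

definition const2 :: "'a::comm_ring_1 \<Rightarrow> 'a fps fps" where
  "const2 c = fps_const (fps_const c)"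

definition tw :: "'a::field_char_0 \<Rightarrow> nat \<Rightarrow> nat \<Rightarrow> 'a fps fps" where
  "tw \<kappa> n m = fps_X ^ n * fps_const (fps_const (mod_ffact \<kappa> m) * fps_X ^ m)"

text \<open>
  The coefficient of $t^n w^m$ in $\sum A(n,m)\, t^n w^{(m)}$ is
  $A(n,m)\, \kappa^{\underline m}$.
\<close>

definition S_space_level ::
  "('a::field_char_0 \<Rightarrow> ereal) \<Rightarrow> 'a set \<Rightarrow> 'a \<Rightarrow> real \<Rightarrow> real \<Rightarrow> real \<Rightarrow> 'a fps fps set" where
  "S_space_level ord K \<kappa> b' \<epsilon> \<rho> =
     {F. \<exists>A. (\<forall>n m. A n m \<in> K \<and>
                ord (A n m) \<ge> ereal (2 * b' * real n + \<epsilon> * real m + \<rho>)) \<and>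
             F = Abs_fps (\<lambda>n. Abs_fps (\<lambda>m. A n m * mod_ffact \<kappa> m))}"

definition S_space ::
  "('a::field_char_0 \<Rightarrow> ereal) \<Rightarrow> 'a set \<Rightarrow> 'a \<Rightarrow> real \<Rightarrow> real \<Rightarrow> 'a fps fps set" where
  "S_space ord K \<kappa> b' \<epsilon> = (\<Union>\<rho>. S_space_level ord K \<kappa> b' \<epsilon> \<rho>)"

text \<open>
  The image of $t^n w^{(m)}$. The first case is $\kappa = k$, $m = k$, the second one is
  $\kappa = k$, $m = k + 1$. For $m = 0$ the factor \<open>of_nat m\<close> removes the terms with
  $w^{(-1)}$.
\<close>

definition del_tw :: "'a::field_char_0 \<Rightarrow> 'a \<Rightarrow> nat \<Rightarrow> nat \<Rightarrow> 'a fps fps" where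
  "del_tw \<pi> \<kappa> n m =
     (if \<kappa> = of_nat m then
        const2 (of_nat n) * tw \<kappa> n m
        + const2 (of_nat m * \<pi>\<^sup>2) * tw \<kappa> (n + 1) (m - 1)
      else if m \<ge> 1 \<and> \<kappa> = of_nat (m - 1) then
        const2 (of_nat n) * tw \<kappa> n m + tw \<kappa> n (m + 1)
        + const2 (of_nat m * \<pi>\<^sup>2) * tw \<kappa> (n + 1) (m - 1)
      else
        const2 (of_nat n) * tw \<kappa> n m + tw \<kappa> n (m + 1)
        + const2 (of_nat m * (\<kappa> - of_nat m + 1) * \<pi>\<^sup>2) * tw \<kappa> (n + 1) (m - 1))"

text \<open>
  The termwise extension $\sum A(n,m)\, t^n w^{(m)} \mapsto
  \sum A(n,m)\, \partial_\kappa(t^n w^{(m)})$, where $A(n,m)$ is recovered from the series by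
  division by $\kappa^{\underline m} \ne 0$. The sum that gives the coefficient of $t^N w^M$
  ranges over the finitely many $(n,m)$ that contribute to it, see \<open>finite_del_tw_support\<close>.
\<close>

definition del :: "'a::field_char_0 \<Rightarrow> 'a \<Rightarrow> 'a fps fps \<Rightarrow> 'a fps fps" where
  "del \<pi> \<kappa> F = Abs_fps (\<lambda>N. Abs_fps (\<lambda>M.
     \<Sum>(n, m) | del_tw \<pi> \<kappa> n m $ N $ M \<noteq> 0.
       F $ n $ m / mod_ffact \<kappa> m * del_tw \<pi> \<kappa> n m $ N $ M))"

lemma tw_nth: "tw \<kappa> n m $ N $ M = (if N = n \<and> M = m then mod_ffact \<kappa> m else 0)"
  by (auto simp: tw_def fps_X_power_mult_nth)

lemma const2_mult_nth: "(const2 c * F) $ N $ M = c * F $ N $ M"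
  by (simp add: const2_def)

lemma finite_del_tw_support: "finite {(n, m). del_tw \<pi> \<kappa> n m $ N $ M \<noteq> 0}"
proof (rule finite_subset)
  have "del_tw \<pi> \<kappa> n m $ N $ M = 0" if "\<not> (n \<le> N \<and> m \<le> M + 1)" for n m
  proof -
    have "tw \<kappa> n m $ N $ M = 0" "tw \<kappa> n (m + 1) $ N $ M = 0" "tw \<kappa> (n + 1) (m - 1) $ N $ M = 0"
      unfolding tw_nth using that by (intro if_not_P; linarith)+
    then show ?thesis
      by (simp only: del_tw_def fps_add_nth const2_mult_nth mult_zero_right add_0_right if_cancel
            split: if_split) blast
  qed
  then show "{(n, m). del_tw \<pi> \<kappa> n m $ N $ M \<noteq> 0} \<subseteq> {..N} \<times> {..M + 1}"
    by fastforce
qed simp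

definition H0 ::
  "('a::field_char_0 \<Rightarrow> ereal) \<Rightarrow> 'a set \<Rightarrow> 'a \<Rightarrow> 'a \<Rightarrow> real \<Rightarrow> real \<Rightarrow> 'a fps fps set" where
  "H0 ord K \<pi> \<kappa> b' \<epsilon> = {F \<in> S_space ord K \<kappa> b' \<epsilon>. del \<pi> \<kappa> F = 0}"

end

theory Submission
  imports Defs
begin

text \<open>
  Comparing coefficients, $\partial_\kappa F = 0$ becomes a recurrence that determines all
  $A(n,m)$ from the $A(0,m)$ and forces $A(0,m) = 0$ unless $\kappa = m$. So only
  $\kappa = k \in \mathbf{Z}_{\ge 0}$ is of interest, where the formal solutions form a line. With
  $f = \sum \pi^{2n} t^n / n!^2$ and $\theta = t\, d/dt$, so that $\theta^2 f = \pi^2 t f$, it is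
  spanned by $\sum_{m \le k} (-1)^{k-m} (k!/m!)\, f^m (\theta f)^{k-m} w^{(m)}$. For $k = 0$ this is
  the constant $1$. For $k \ge 1$ the coefficient of $w^{(k)}$ is $f^k$, and the valuation of the
  coefficient of $t^{p^j}$ in $f^k$ is at most $\mathrm{ord}\, k + 2/(p-1)$ for all $j$, which
  is incompatible with growth at least $2b'n$.
\<close>

section \<open>The recurrence for the kernel\<close>

text \<open>Indexed by the target: up to \<pi>^2 it is the coefficient of t^(n+1) w^(M) in the image
  of t^n w^(M+1). At \<kappa> = M the factor \<kappa> - M, which would vanish, is replaced by 1, as
  in \<open>mod_ffact\<close>.\<close>

definition lowering_coeff :: "'a::field_char_0 \<Rightarrow> nat \<Rightarrow> 'a" where
  "lowering_coeff \<kappa> M =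
     (if \<kappa> = of_nat M then of_nat (Suc M) else of_nat (Suc M) * (\<kappa> - of_nat M))"

text \<open>The matrix of the operator in the basis \<open>tw\<close>. The factor
  \<open>mod_ffact \<kappa> M\<close> comes from reading off w^M in w^(M). The guards on
  \<open>M\<close> and \<open>N\<close> neutralise the truncated subtractions.\<close>

lemma del_tw_nth:
  "del_tw \<pi> \<kappa> n m $ N $ M = mod_ffact \<kappa> M *
     ((if (n, m) = (N, M) then of_nat N else 0)
      + (if (n, m) = (N, M - 1) \<and> M \<ge> 1 \<and> \<kappa> \<noteq> of_nat (M - 1) then 1 else 0)
      + (if (n, m) = (N - 1, M + 1) \<and> N \<ge> 1 then lowering_coeff \<kappa> M * \<pi>\<^sup>2 else 0))"
proof (cases m)
  case 0
  then show ?thesis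
    by (auto simp: del_tw_def tw_nth const2_mult_nth)
next
  case (Suc l)
  \<comment> \<open>The three cases of the definition merge: for \<kappa> = l + 1 the factor
    \<kappa> - l is 1, and for \<kappa> = l \<open>lowering_coeff\<close> has the exceptional
    value.\<close>
  have "del_tw \<pi> \<kappa> n (Suc l) = const2 (of_nat n) * tw \<kappa> n (Suc l)
      + (if \<kappa> = of_nat (Suc l) then 0 else tw \<kappa> n (Suc (Suc l)))
      + const2 (lowering_coeff \<kappa> l * \<pi>\<^sup>2) * tw \<kappa> (Suc n) l"
  proof -
    consider "\<kappa> = of_nat (Suc l)" | "\<kappa> = of_nat l" | "\<kappa> \<noteq> of_nat (Suc l)" "\<kappa> \<noteq> of_nat l"
      by blast
    then show ?thesis
      by cases (simp_all add: del_tw_def lowering_coeff_def)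
  qed
  moreover have "(if C then 0 else F) $ N $ M = (if C then 0 else F $ N $ M)"
    for C and F :: "'a fps fps"
    by simp
  ultimately have nth: "del_tw \<pi> \<kappa> n (Suc l) $ N $ M =
      of_nat n * (if N = n \<and> M = Suc l then mod_ffact \<kappa> (Suc l) else 0)
      + (if \<kappa> = of_nat (Suc l) then 0
         else if N = n \<and> M = Suc (Suc l) then mod_ffact \<kappa> (Suc (Suc l)) else 0)
      + lowering_coeff \<kappa> l * \<pi>\<^sup>2 * (if N = Suc n \<and> M = l then mod_ffact \<kappa> l else 0)"
    by (simp only: fps_add_nth const2_mult_nth tw_nth)
  consider "N = n" "M = Suc l" | "N = n" "M = Suc (Suc l)" | "N = Suc n" "M = l"
    | "\<not> (N = n \<and> M = Suc l)" "\<not> (N = n \<and> M = Suc (Suc l))" "\<not> (N = Suc n \<and> M = l)"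
    by blast
  then show ?thesis
  proof cases
    case 1
    show ?thesis unfolding Suc nth by (simp add: 1 del: of_nat_Suc)
  next
    case 2
    show ?thesis unfolding Suc nth by (simp add: 2 del: of_nat_Suc)
  next
    case 3
    show ?thesis unfolding Suc nth by (simp add: 3 del: of_nat_Suc)
  next
    case 4
    then have "((n, Suc l) = (N, M)) = False"
      "((n, Suc l) = (N, M - 1) \<and> M \<ge> 1 \<and> \<kappa> \<noteq> of_nat (M - 1)) = False"
      "((n, Suc l) = (N - 1, M + 1) \<and> N \<ge> 1) = False"
      by auto
    then show ?thesis
      unfolding Suc nth
      by (simp only: 4 if_False if_cancel mult_zero_right add_0_right)
  qed
qed

lemma del_nth:
  fixes \<pi> \<kappa> :: "'a::field_char_0"
  defines "A \<equiv> \<lambda>F n m. F $ n $ m / mod_ffact \<kappa> m"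
  shows "del \<pi> \<kappa> F $ N $ M = mod_ffact \<kappa> M *
     (of_nat N * A F N M
      + (if M \<ge> 1 \<and> \<kappa> \<noteq> of_nat (M - 1) then A F N (M - 1) else 0)
      + (if N \<ge> 1 then lowering_coeff \<kappa> M * \<pi>\<^sup>2 * A F (N - 1) (M + 1) else 0))"
proof -
  \<comment> \<open>A box that contains the support and also the three relevant positions, even when
    a truncated subtraction makes two of them coincide, so that each summand becomes a delta
    sum.\<close>
  define S where "S = {..N} \<times> {..M + 1}"
  have fin: "finite S" by (simp add: S_def)
  have mem: "(N, M) \<in> S" "(N, M - 1) \<in> S" "(N - 1, M + 1) \<in> S" by (auto simp: S_def)
  have "del \<pi> \<kappa> F $ N $ M =
      (\<Sum>(n, m) | del_tw \<pi> \<kappa> n m $ N $ M \<noteq> 0. A F n m * del_tw \<pi> \<kappa> n m $ N $ M)"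
    by (simp add: del_def A_def)
  also have "\<dots> = (\<Sum>(n, m) \<in> S. A F n m * del_tw \<pi> \<kappa> n m $ N $ M)"
    by (rule sum.mono_neutral_left)
       (auto simp: S_def del_tw_nth split: if_splits)
  also have "\<dots> = (\<Sum>x \<in> S. mod_ffact \<kappa> M * (
      (if x = (N, M) then of_nat N * A F N M else 0)
      + (if x = (N, M - 1) then
           if M \<ge> 1 \<and> \<kappa> \<noteq> of_nat (M - 1) then A F N (M - 1) else 0 else 0)
      + (if x = (N - 1, M + 1) then
           if N \<ge> 1 then lowering_coeff \<kappa> M * \<pi>\<^sup>2 * A F (N - 1) (M + 1) else 0 else 0)))"
  proof (rule sum.cong[OF refl], safe)
    fix n m
    have gen: "a * (f * ((if P then e else 0) + (if Q \<and> Q' then 1 else 0) + (if R \<and> R' then l else 0)))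
        = f * ((if P then e * a1 else 0) + (if Q then if Q' then a2 else 0 else 0)
               + (if R then if R' then l * a3 else 0 else 0))"
      if "P \<Longrightarrow> a = a1" "Q \<Longrightarrow> a = a2" "R \<Longrightarrow> a = a3"
      for a a1 a2 a3 e f l :: 'a and P Q Q' R R'
      using that by (cases P; cases Q; cases R) (auto simp: algebra_simps)
    show "A F n m * del_tw \<pi> \<kappa> n m $ N $ M = mod_ffact \<kappa> M * (
        (if (n, m) = (N, M) then of_nat N * A F N M else 0)
        + (if (n, m) = (N, M - 1) then
             if M \<ge> 1 \<and> \<kappa> \<noteq> of_nat (M - 1) then A F N (M - 1) else 0 else 0)
        + (if (n, m) = (N - 1, M + 1) then
             if N \<ge> 1 then lowering_coeff \<kappa> M * \<pi>\<^sup>2 * A F (N - 1) (M + 1) else 0 else 0))"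
      unfolding del_tw_nth by (rule gen) auto
  qed
  also have "\<dots> = mod_ffact \<kappa> M * (
      of_nat N * A F N M
      + (if M \<ge> 1 \<and> \<kappa> \<noteq> of_nat (M - 1) then A F N (M - 1) else 0)
      + (if N \<ge> 1 then lowering_coeff \<kappa> M * \<pi>\<^sup>2 * A F (N - 1) (M + 1) else 0))"
    unfolding sum_distrib_left[symmetric] sum.distrib sum.delta[OF fin]
    by (simp only: mem if_True)
  finally show ?thesis .
qed

definition kernel_recurrence :: "'a::field_char_0 \<Rightarrow> 'a \<Rightarrow> (nat \<Rightarrow> nat \<Rightarrow> 'a) \<Rightarrow> bool" where
  "kernel_recurrence \<pi> \<kappa> A \<longleftrightarrow> (\<forall>N M. of_nat N * A N M
      + (if M \<ge> 1 \<and> \<kappa> \<noteq> of_nat (M - 1) then A N (M - 1) else 0)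
      + (if N \<ge> 1 then lowering_coeff \<kappa> M * \<pi>\<^sup>2 * A (N - 1) (M + 1) else 0) = 0)"

lemma del_eq_0_iff:
  "del \<pi> \<kappa> F = 0 \<longleftrightarrow> kernel_recurrence \<pi> \<kappa> (\<lambda>n m. F $ n $ m / mod_ffact \<kappa> m)"
  unfolding kernel_recurrence_def fps_eq_iff
  by (simp add: del_nth mod_ffact_nonzero)

lemma kernel_recurrence_diff:
  assumes "kernel_recurrence \<pi> \<kappa> A" "kernel_recurrence \<pi> \<kappa> B"
  shows "kernel_recurrence \<pi> \<kappa> (\<lambda>n m. A n m - c * B n m)"
  unfolding kernel_recurrence_def
proof (intro allI)
  fix N M
  let ?L = "\<lambda>A. of_nat N * A N M
      + (if M \<ge> 1 \<and> \<kappa> \<noteq> of_nat (M - 1) then A N (M - 1) else 0)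
      + (if N \<ge> 1 then lowering_coeff \<kappa> M * \<pi>\<^sup>2 * A (N - 1) (M + 1) else 0)"
  have "e * (x - c * y) + (if P then x' - c * y' else 0) + (if Q then l * (x'' - c * y'') else 0)
      = (e * x + (if P then x' else 0) + (if Q then l * x'' else 0))
        - c * (e * y + (if P then y' else 0) + (if Q then l * y'' else 0))"
    for e l x y x' y' x'' y'' :: 'a and P Q
    by (simp add: algebra_simps)
  then have "?L (\<lambda>n m. A n m - c * B n m) = ?L A - c * ?L B" .
  also have "\<dots> = 0"
    using assms by (simp only: kernel_recurrence_def) simp
  finally show "?L (\<lambda>n m. A n m - c * B n m) = 0" .
qed

text \<open>If row n vanishes, the lowering term drops out of the equations for row n + 1. These are
  then triangular in m with diagonal entry n + 1, which is nonzero in characteristic 0.\<close>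

lemma kernel_recurrence_unique:
  assumes rec: "kernel_recurrence \<pi> \<kappa> A" and init: "\<And>m. A 0 m = 0"
  shows "A n m = 0"
proof (induction n arbitrary: m)
  case 0
  show ?case by (rule init)
next
  case (Suc n)
  have eq: "of_nat (Suc n) * A (Suc n) M
      + (if M \<ge> 1 \<and> \<kappa> \<noteq> of_nat (M - 1) then A (Suc n) (M - 1) else 0) = 0" for M
    using rec[unfolded kernel_recurrence_def, rule_format, of "Suc n" M] Suc.IH by simp
  show ?case
  proof (induction m)
    case 0
    show ?case using eq[of 0] by (simp del: of_nat_Suc)
  next
    case (Suc m)
    show ?case using eq[of "Suc m"] Suc.IH by (simp del: of_nat_Suc split: if_splits)
  qed
qed

text \<open>At N = 0 and M = m + 1 only the raising term survives, and it is present exactly when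
  \<kappa> differs from m.\<close>

lemma kernel_recurrence_initial:
  assumes "kernel_recurrence \<pi> \<kappa> A" "\<kappa> \<noteq> of_nat m"
  shows "A 0 m = 0"
  using assms(1)[unfolded kernel_recurrence_def, rule_format, of 0 "Suc m"] assms(2) by simp

section \<open>The formal solution at a natural number\<close>

text \<open>This is I_0(2 \<pi> sqrt t), with I_0 the modified Bessel function.\<close>

definition bessel :: "'a::field_char_0 \<Rightarrow> 'a fps" where
  "bessel \<pi> = Abs_fps (\<lambda>n. \<pi> ^ (2 * n) / (fact n)\<^sup>2)"

lemma bessel_nth: "bessel \<pi> $ n = \<pi> ^ (2 * n) / (fact n)\<^sup>2"
  by (simp add: bessel_def)

definition euler :: "'a::field_char_0 fps \<Rightarrow> 'a fps" where
  "euler f = fps_X * fps_deriv f"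

lemma euler_nth: "euler f $ n = of_nat n * f $ n"
  by (cases n) (simp_all add: euler_def)

lemma euler_mult: "euler (f * g) = euler f * g + f * euler g"
  by (simp add: euler_def algebra_simps)

lemma euler_const_mult: "euler (fps_const c * g) = fps_const c * euler g"
  by (simp add: euler_def algebra_simps)

lemma euler_power: "euler (f ^ n) = fps_const (of_nat n) * f ^ (n - 1) * euler f"
  by (simp add: euler_def fps_deriv_power algebra_simps)

lemma euler_euler_bessel: "euler (euler (bessel \<pi>)) = fps_const (\<pi>\<^sup>2) * fps_X * bessel \<pi>"
proof (rule fps_ext)
  fix n
  show "euler (euler (bessel \<pi>)) $ n = (fps_const (\<pi>\<^sup>2) * fps_X * bessel \<pi>) $ n"
  proof (cases n)
    case (Suc m)
    have "(of_nat (Suc m) :: 'a) \<noteq> 0" by (simp del: of_nat_Suc)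
    then show ?thesis using Suc
      by (simp add: euler_nth bessel_nth mult.assoc power2_eq_square field_simps del: of_nat_Suc)
  qed (simp add: euler_nth mult.assoc)
qed

text \<open>The system for \<open>\<kappa> = k\<close> is the \<open>k\<close>-th symmetric power of the Bessel equation.\<close>

definition sym_bessel :: "'a::field_char_0 \<Rightarrow> nat \<Rightarrow> nat \<Rightarrow> 'a fps" where
  "sym_bessel \<pi> k m = (if m \<le> k then
     fps_const ((-1) ^ (k - m) * fact k / fact m) * (bessel \<pi> ^ m * euler (bessel \<pi>) ^ (k - m))
     else 0)"

lemma sym_bessel_nth_0: "sym_bessel \<pi> k m $ 0 = (if m = k then 1 else 0)"
proof -
  have "euler (bessel \<pi>) $ 0 = 0" by (simp add: euler_nth)
  then show ?thesis
    by (auto simp: sym_bessel_def fps_power_zeroth bessel_nth)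
qed

text \<open>Leibniz rule: differentiating a factor f gives \<theta>f and lowers m, differentiating a
  factor \<theta>f gives \<pi>^2 t f and raises m. The scalars (-1)^(k-m) k!/m! turn the coefficient
  of the lowered term into -1.\<close>

lemma euler_sym_bessel:
  assumes "m \<le> k"
  shows "euler (sym_bessel \<pi> k m) =
    - (if m \<ge> 1 then sym_bessel \<pi> k (m - 1) else 0)
    - fps_const (of_nat (Suc m) * of_nat (k - m) * \<pi>\<^sup>2) * fps_X * sym_bessel \<pi> k (m + 1)"
proof -
  let ?f = "bessel \<pi>" and ?g = "euler (bessel \<pi>)"
  define c where "c m = ((-1) ^ (k - m) * fact k / fact m :: 'a)" for m
  have lower: "fps_const (c m * of_nat m) * (?f ^ (m - 1) * ?g ^ Suc (k - m)) =
      - (if m \<ge> 1 then sym_bessel \<pi> k (m - 1) else 0)"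
  proof (cases m)
    case (Suc l)
    have "c m * of_nat m = - c l"
    proof -
      have "k - l = Suc (k - m)" using Suc assms by simp
      moreover have "(of_nat (Suc l) :: 'a) \<noteq> 0" by (simp del: of_nat_Suc)
      ultimately show ?thesis
        by (simp add: c_def Suc field_simps del: of_nat_Suc)
    qed
    moreover have "Suc (k - m) = k - l" using Suc assms by simp
    ultimately show ?thesis
      using Suc assms
      by (simp add: sym_bessel_def c_def[symmetric] fps_const_neg[symmetric]
            del: fps_const_neg power_Suc)
  qed simp
  \<comment> \<open>For m = k both sides vanish because of the factor k - m.\<close>
  have upper: "fps_const (c m * of_nat (k - m)) * (?f ^ Suc m * ?g ^ (k - m - 1)) =
      - fps_const (of_nat (Suc m) * of_nat (k - m)) * sym_bessel \<pi> k (m + 1)"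
  proof (cases "m = k")
    case False
    with assms have "k - m = Suc (k - Suc m)" by simp
    moreover have "(of_nat (Suc m) :: 'a) \<noteq> 0" by (simp del: of_nat_Suc)
    ultimately have "c m = - (of_nat (Suc m) * c (Suc m))"
      by (simp add: c_def field_simps del: of_nat_Suc)
    then have "fps_const (c m * of_nat (k - m)) =
        - fps_const (of_nat (Suc m) * of_nat (k - m)) * fps_const (c (Suc m))"
      by (simp add: mult_ac)
    moreover have "sym_bessel \<pi> k (m + 1) = fps_const (c (Suc m)) * (?f ^ Suc m * ?g ^ (k - m - 1))"
      using False assms by (simp add: sym_bessel_def c_def)
    ultimately show ?thesis
      by (simp only: mult.assoc)
  qed simp
  have "euler (sym_bessel \<pi> k m) =
      fps_const (c m) * (fps_const (of_nat m) * ?f ^ (m - 1) * ?g * ?g ^ (k - m)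
        + ?f ^ m * (fps_const (of_nat (k - m)) * ?g ^ (k - m - 1)
           * (fps_const (\<pi>\<^sup>2) * fps_X * ?f)))"
  proof -
    have "sym_bessel \<pi> k m = fps_const (c m) * (?f ^ m * ?g ^ (k - m))"
      using assms by (simp add: sym_bessel_def c_def)
    then show ?thesis
      by (simp only: euler_const_mult) (simp only: euler_mult euler_power euler_euler_bessel)
  qed
  also have "\<dots> = fps_const (c m * of_nat m) * (?f ^ (m - 1) * ?g ^ Suc (k - m))
      + fps_const (\<pi>\<^sup>2) * fps_X
        * (fps_const (c m * of_nat (k - m)) * (?f ^ Suc m * ?g ^ (k - m - 1)))"
    unfolding fps_const_mult[symmetric] power_Suc by (simp only: algebra_simps)
  finally show ?thesis
    unfolding lower upper
    by (simp add: fps_const_mult[symmetric] mult_ac del: fps_const_mult of_nat_Suc)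
qed

lemma kernel_recurrence_sym_bessel:
  fixes \<pi> :: "'a::field_char_0"
  shows "kernel_recurrence \<pi> (of_nat k) (\<lambda>n m. sym_bessel \<pi> k m $ n)"
  unfolding kernel_recurrence_def
proof (intro allI)
  fix N M
  show "of_nat N * sym_bessel \<pi> k M $ N
      + (if M \<ge> 1 \<and> of_nat k \<noteq> (of_nat (M - 1) :: 'a) then sym_bessel \<pi> k (M - 1) $ N else 0)
      + (if N \<ge> 1 then lowering_coeff (of_nat k) M * \<pi>\<^sup>2 * sym_bessel \<pi> k (M + 1) $ (N - 1) else 0)
      = 0"
  proof (cases "M \<le> k")
    case True
    \<comment> \<open>The two coefficients differ only at M = k, where they multiply
      \<open>sym_bessel \<pi> k (k + 1)\<close>, which is 0.\<close>
    have "lowering_coeff (of_nat k) M * sym_bessel \<pi> k (M + 1) $ (N - 1)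
        = of_nat (Suc M) * of_nat (k - M) * sym_bessel \<pi> k (M + 1) $ (N - 1)"
      using True by (auto simp: lowering_coeff_def of_nat_diff sym_bessel_def)
    moreover have "of_nat N * sym_bessel \<pi> k M $ N =
      - (if M \<ge> 1 then sym_bessel \<pi> k (M - 1) $ N else 0)
      - of_nat (Suc M) * of_nat (k - M) * \<pi>\<^sup>2
        * (if N = 0 then 0 else sym_bessel \<pi> k (M + 1) $ (N - 1))"
      using arg_cong[OF euler_sym_bessel[OF True, of \<pi>], of "\<lambda>f. f $ N"]
      by (simp add: euler_nth mult.assoc del: of_nat_Suc)
    ultimately show ?thesis
      using True by (auto simp: mult_ac)
  next
    case False
    \<comment> \<open>The raising term vanishes for l = k by its guard, and for l > k because
      \<open>sym_bessel \<pi> k l\<close> is 0.\<close>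
    then obtain l where "M = Suc l" "k \<le> l" by (cases M) auto
    then show ?thesis by (auto simp: sym_bessel_def)
  qed
qed

text \<open>Row 0 of any solution is concentrated at m = k, and \<open>sym_bessel\<close> has the
  value 1 there. Subtracting the right multiple leaves a solution with zero initial row.\<close>

lemma kernel_recurrence_of_nat:
  assumes "kernel_recurrence \<pi> (of_nat k) A"
  shows "A n m = A 0 k * sym_bessel \<pi> k m $ n"
proof -
  have "kernel_recurrence \<pi> (of_nat k) (\<lambda>n m. A n m - A 0 k * sym_bessel \<pi> k m $ n)"
    by (rule kernel_recurrence_diff[OF assms kernel_recurrence_sym_bessel])
  moreover have "A 0 m - A 0 k * sym_bessel \<pi> k m $ 0 = 0" for m
    using kernel_recurrence_initial[OF assms, of m] by (auto simp: sym_bessel_nth_0)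
  ultimately have "A n m - A 0 k * sym_bessel \<pi> k m $ n = 0"
    by (rule kernel_recurrence_unique)
  then show ?thesis by simp
qed

section \<open>Valuations of the coefficients\<close>

text \<open>The multiples of p up to pq + r are p, 2p, ..., qp; taking one p out of each leaves q!.
  Iterated, this is Legendre's formula (p - 1) v(n!) = n - s(n), with s(n) the sum of the base p
  digits.\<close>

lemma multiplicity_fact_mult_add:
  assumes "prime p" "r < p"
  shows "multiplicity p (fact (p * q + r) :: nat) = q + multiplicity p (fact q :: nat)"
proof -
  have step: "multiplicity p (fact (p * q + r) :: nat) = multiplicity p (fact (p * q) :: nat)"
    if "r < p" for q r
    using that
  proof (induction r)
    case (Suc r)
    have "\<not> p dvd Suc (p * q + r)"
    proof
      assume "p dvd Suc (p * q + r)"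
      then have "p dvd p * q + Suc r" by simp
      then have "p dvd Suc r" by (metis dvd_add_right_iff dvd_triv_left)
      then show False using Suc.prems by (auto dest: dvd_imp_le)
    qed
    then have "multiplicity p (Suc (p * q + r)) = 0" by (rule not_dvd_imp_multiplicity_0)
    moreover have "(fact (p * q + Suc r) :: nat) = Suc (p * q + r) * fact (p * q + r)" by simp
    ultimately show ?case
      using Suc assms(1) by (simp add: prime_elem_multiplicity_mult_distrib del: mult_Suc fact_Suc)
  qed simp
  have "multiplicity p (fact (p * q) :: nat) = q + multiplicity p (fact q :: nat)"
  proof (induction q)
    case (Suc q)
    have p: "p > 0" using assms(1) prime_gt_0_nat by blast
    have "p * Suc q = Suc (p * q + (p - 1))" using p by simp
    then have "(fact (p * Suc q) :: nat) = (p * Suc q) * fact (p * q + (p - 1))"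
      by (metis fact_Suc of_nat_id)
    then have "multiplicity p (fact (p * Suc q) :: nat) =
        multiplicity p (p * Suc q) + multiplicity p (fact (p * q) :: nat)"
      using assms(1) p step[of "p - 1" q]
      by (simp add: prime_elem_multiplicity_mult_distrib del: mult_Suc_right)
    moreover have "multiplicity p (p * Suc q) = Suc (multiplicity p (Suc q))"
      using assms(1) p
      by (simp add: prime_elem_multiplicity_mult_distrib multiplicity_self del: mult_Suc_right)
    moreover have "multiplicity p (fact (Suc q) :: nat) =
        multiplicity p (Suc q) + multiplicity p (fact q :: nat)"
      using assms(1) by (simp add: prime_elem_multiplicity_mult_distrib fact_Suc del: mult_Suc)
    ultimately show ?case using Suc by simp
  qed simp
  with step[OF assms(2)] show ?thesis by simp
qed

text \<open>The digit sum of a positive integer is at least 1. The induction runs through n div p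
  instead of through digits.\<close>

lemma multiplicity_fact_le:
  assumes "prime p" "n \<ge> 1"
  shows "(p - 1) * multiplicity p (fact n :: nat) \<le> n - 1"
  using assms(2)
proof (induction n rule: less_induct)
  case (less n)
  have p: "p \<ge> 2" using assms(1) by (rule prime_ge_2_nat)
  define q where "q = n div p"
  have n: "n = p * q + n mod p" by (simp add: q_def)
  have m: "multiplicity p (fact n :: nat) = q + multiplicity p (fact q :: nat)"
    using multiplicity_fact_mult_add[OF assms(1), of "n mod p" q] p n by simp
  show ?case
  proof (cases "q = 0")
    case False
    have "q < n" unfolding q_def using p less.prems by simp
    then have "(p - 1) * multiplicity p (fact q :: nat) \<le> q - 1" using less.IH False by simp
    then have "(p - 1) * multiplicity p (fact n :: nat) \<le> (p - 1) * q + (q - 1)"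
      unfolding m by (simp add: distrib_left)
    also have "\<dots> = p * q - 1" using p False by (cases p; cases q) auto
    also have "\<dots> \<le> n - 1" using n by linarith
    finally show ?thesis .
  qed (simp add: m)
qed

text \<open>Equality in the preceding bound, since the digit sum of a power of p is 1.\<close>

lemma multiplicity_fact_prime_power:
  assumes "prime p"
  shows "(p - 1) * multiplicity p (fact (p ^ j) :: nat) = p ^ j - 1"
proof (induction j)
  case (Suc j)
  have p: "p \<ge> 2" using assms by (rule prime_ge_2_nat)
  have "multiplicity p (fact (p ^ Suc j) :: nat) = p ^ j + multiplicity p (fact (p ^ j) :: nat)"
    using multiplicity_fact_mult_add[OF assms, of 0 "p ^ j"] p by simp
  then have "(p - 1) * multiplicity p (fact (p ^ Suc j) :: nat) = (p - 1) * p ^ j + (p ^ j - 1)"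
    using Suc by (simp add: distrib_left)
  also have "\<dots> = p ^ Suc j - 1" using p by (cases p; cases "p ^ j") auto
  finally show ?case .
qed simp

context padic_closure
begin

section \<open>Elementary properties of the valuation\<close>

lemma ord_zero: "ord 0 = \<infinity>"
  by (simp add: ord_eq_infinity_iff)

lemma ord_real:
  assumes "x \<noteq> 0"
  obtains r where "ord x = ereal r"
  using assms ord_eq_infinity_iff[of x] ord_neq_minus_infinity[of x] by (cases "ord x") auto

lemma ord_one: "ord 1 = 0"
proof -
  obtain r where "ord 1 = ereal r" by (rule ord_real[of 1]) auto
  with ord_mult[of 1 1] show ?thesis by simp
qed

lemma ord_minus: "ord (- x) = ord x"
proof -
  obtain r where "ord (-1) = ereal r" by (rule ord_real[of "-1"]) auto
  with ord_mult[of "-1" "-1"] have "ord (-1) = 0" by (simp add: ord_one)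
  with ord_mult[of "-1" x] show ?thesis by simp
qed

lemma ord_power: "ord x = ereal r \<Longrightarrow> ord (x ^ n) = ereal (real n * r)"
  by (induction n) (simp_all add: ord_one ord_mult algebra_simps)

lemma ord_divide:
  assumes "ord x = ereal r" "ord y = ereal s"
  shows "ord (x / y) = ereal (r - s)"
proof -
  have "x \<noteq> 0" "y \<noteq> 0" using assms ord_zero by auto
  then have "x / y \<noteq> 0" "x / y * y = x" by auto
  obtain t where "ord (x / y) = ereal t" by (rule ord_real[OF \<open>x / y \<noteq> 0\<close>])
  with ord_mult[of "x / y" y] assms \<open>x / y * y = x\<close> show ?thesis by simp
qed

lemma ord_add_ge: "c \<le> ord x \<Longrightarrow> c \<le> ord y \<Longrightarrow> c \<le> ord (x + y)"
  using ord_add[of x y] by (meson min.boundedI order_trans)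

lemma ord_diff_ge: "c \<le> ord x \<Longrightarrow> c \<le> ord y \<Longrightarrow> c \<le> ord (x - y)"
  using ord_add_ge[of c x "- y"] by (simp add: ord_minus)

lemma ord_sum_ge: "(\<And>i. i \<in> I \<Longrightarrow> c \<le> ord (f i)) \<Longrightarrow> c \<le> ord (sum f I)"
  by (induction I rule: infinite_finite_induct) (auto simp: ord_zero intro: ord_add_ge)

lemma ord_mult_ge: "ereal r \<le> ord x \<Longrightarrow> ereal s \<le> ord y \<Longrightarrow> ereal (r + s) \<le> ord (x * y)"
  unfolding ord_mult plus_ereal.simps(1)[symmetric] by (rule add_mono)

lemma ord_of_nat_ge: "0 \<le> ord (of_nat n)"
  by (induction n) (auto simp: ord_zero ord_one intro: ord_add_ge)

text \<open>By Bezout n x - p y = 1; if n had positive valuation, so would 1.\<close>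

lemma ord_of_nat_coprime:
  assumes "\<not> p dvd n"
  shows "ord (of_nat n) = 0"
proof -
  have "coprime n p" using prime_imp_coprime[OF prime_p assms] by (simp add: coprime_commute)
  moreover have "n \<noteq> 0" using assms by (metis dvd_0_right)
  ultimately obtain x y where xy: "n * x = p * y + 1"
    using bezout_nat[of n p] by auto
  obtain r where r: "ord (of_nat n) = ereal r"
    by (rule ord_real[of "of_nat n"]) (use \<open>n \<noteq> 0\<close> in auto)
  have "r \<ge> 0" using ord_of_nat_ge[of n] r by simp
  moreover have "\<not> r > 0"
  proof
    assume "r > 0"
    have "1 = (of_nat n * of_nat x - of_nat p * of_nat y :: 'a)"
      using arg_cong[OF xy, of "of_nat :: nat \<Rightarrow> 'a"] by simp
    moreover have "ereal (min r 1) \<le> ord (of_nat n * of_nat x)"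
      using ord_mult_ge[of r "of_nat n" 0 "of_nat x"] r ord_of_nat_ge[of x]
      by (auto simp: zero_ereal_def intro: order_trans[rotated])
    moreover have "ereal (min r 1) \<le> ord (of_nat p * of_nat y)"
      using ord_mult_ge[of 1 "of_nat p" 0 "of_nat y"] ord_p ord_of_nat_ge[of y]
      by (auto simp: zero_ereal_def one_ereal_def intro: order_trans[rotated])
    ultimately have "ereal (min r 1) \<le> ord 1" by (metis ord_diff_ge)
    then show False using \<open>r > 0\<close> by (simp add: ord_one min_def split: if_splits)
  qed
  ultimately show ?thesis using r by simp
qed

lemma ord_of_nat:
  assumes "n > 0"
  shows "ord (of_nat n) = ereal (real (multiplicity p n))"
proof -
  have "n \<noteq> 0" "\<not> is_unit p" using assms prime_p by auto
  then obtain m where m: "n = p ^ multiplicity p n * m" "\<not> p dvd m"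
    by (rule multiplicity_decompose')
  have "ord (of_nat n) = ord (of_nat p ^ multiplicity p n * of_nat m)"
    using arg_cong[OF m(1), of "of_nat :: nat \<Rightarrow> 'a"] by simp
  also have "\<dots> = ereal (real (multiplicity p n))"
    using ord_power[of "of_nat p" 1 "multiplicity p n"] ord_p ord_of_nat_coprime[OF m(2)]
    by (simp add: ord_mult one_ereal_def)
  finally show ?thesis .
qed

lemma ord_fact: "ord (fact n) = ereal (real (multiplicity p (fact n :: nat)))"
  using ord_of_nat[of "fact n"] by simp

lemma real_p_minus_1: "real (p - 1) = real p - 1" "real p - 1 > 0"
  using prime_ge_2_nat[OF prime_p] by auto

section \<open>Valuations of \<pi>, of the Bessel coefficients and of powers of the series\<close>

lemma ord_pi:
  assumes "\<pi> ^ (p - 1) = - of_nat p"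
  shows "ord \<pi> = ereal (1 / (real p - 1))"
proof -
  have "\<pi> \<noteq> 0"
    using assms prime_ge_2_nat[OF prime_p] by (auto simp: power_0_left split: if_splits)
  then obtain r where r: "ord \<pi> = ereal r" by (rule ord_real)
  then have "(real p - 1) * r = 1"
    using ord_power[OF r, of "p - 1"] assms real_p_minus_1
    by (simp add: ord_minus ord_p one_ereal_def)
  then show ?thesis using r real_p_minus_1 by (simp add: field_simps)
qed

text \<open>By Legendre's formula the value is 2 s(n)/(p - 1) with s(n) the base p digit sum. So
  among n \<ge> 1 it is smallest at the powers of p.\<close>

lemma ord_bessel_nth:
  assumes "\<pi> ^ (p - 1) = - of_nat p"
  shows "ord (bessel \<pi> $ n) =
    ereal (2 * (real n - (real p - 1) * real (multiplicity p (fact n :: nat))) / (real p - 1))"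
proof -
  have "ord (bessel \<pi> $ n) = ereal (real (2 * n) * (1 / (real p - 1)) -
      real 2 * real (multiplicity p (fact n :: nat)))"
    unfolding bessel_nth by (intro ord_divide ord_power ord_pi ord_fact assms)
  then show ?thesis using real_p_minus_1 by (simp add: field_simps)
qed

lemma ord_bessel_nth_ge:
  assumes "\<pi> ^ (p - 1) = - of_nat p" "n \<ge> 1"
  shows "ereal (2 / (real p - 1)) \<le> ord (bessel \<pi> $ n)"
proof -
  have "real ((p - 1) * multiplicity p (fact n :: nat)) \<le> real (n - 1)"
    using multiplicity_fact_le[OF prime_p assms(2)] by (simp only: of_nat_le_iff)
  then have "(real p - 1) * real (multiplicity p (fact n :: nat)) \<le> real n - 1"
    using assms(2) real_p_minus_1 by (simp add: of_nat_diff)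
  then show ?thesis
    unfolding ord_bessel_nth[OF assms(1)] using real_p_minus_1 by (simp add: divide_right_mono)
qed

lemma ord_bessel_nth_prime_power:
  assumes "\<pi> ^ (p - 1) = - of_nat p"
  shows "ord (bessel \<pi> $ (p ^ j)) = ereal (2 / (real p - 1))"
proof -
  have "p ^ j \<ge> 1" using prime_gt_0_nat[OF prime_p] by simp
  moreover have "real ((p - 1) * multiplicity p (fact (p ^ j) :: nat)) = real (p ^ j - 1)"
    using multiplicity_fact_prime_power[OF prime_p] by simp
  ultimately have "(real p - 1) * real (multiplicity p (fact (p ^ j) :: nat)) = real (p ^ j) - 1"
    using real_p_minus_1 by (simp add: of_nat_diff)
  then show ?thesis
    unfolding ord_bessel_nth[OF assms(1)] by simp
qed

lemma ord_fps_mult_ge: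
  assumes "\<And>n. ereal r \<le> ord (f $ n)" "\<And>n. ereal s \<le> ord (g $ n)"
  shows "ereal (r + s) \<le> ord ((f * g) $ n)"
  unfolding fps_mult_nth by (intro ord_sum_ge ord_mult_ge assms)

lemma ord_fps_power_ge:
  assumes "\<And>n. ereal r \<le> ord (f $ n)"
  shows "ereal (real i * r) \<le> ord ((f ^ i) $ n)"
proof (induction i arbitrary: n)
  case 0
  show ?case by (simp add: ord_one ord_zero zero_ereal_def[symmetric])
next
  case (Suc i)
  show ?case using ord_fps_mult_ge[of r f "real i * r" "f ^ i"] assms Suc
    by (simp add: algebra_simps)
qed

text \<open>From i (k choose i) = k (k-1 choose i-1), the valuation is at least that of k minus that
  of i. The latter is at most that of i!, hence at most (i - 1)/(p - 1).\<close>

lemma ord_binomial_ge: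
  assumes "1 \<le> i" "i \<le> k"
  shows "ereal (real (multiplicity p k) - real (i - 1) / (real p - 1)) \<le> ord (of_nat (k choose i))"
proof -
  have pos: "k choose i > 0" "(k - 1) choose (i - 1) > 0" using assms by auto
  have "i * (k choose i) = k * ((k - 1) choose (i - 1))"
    using assms by (simp add: times_binomial_minus1_eq)
  then have "multiplicity p i + multiplicity p (k choose i)
      = multiplicity p k + multiplicity p ((k - 1) choose (i - 1))"
    using pos assms prime_p by (metis prime_elem_multiplicity_mult_distrib prime_imp_prime_elem
        not_one_le_zero le_trans less_numeral_extra(3))
  moreover have "real (multiplicity p i) \<le> real (i - 1) / (real p - 1)"
  proof -
    have "i dvd fact i" using assms by (simp add: dvd_fact)
    then have "multiplicity p i \<le> multiplicity p (fact i :: nat)"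
      by (rule dvd_imp_multiplicity_le) simp
    then have "(p - 1) * multiplicity p i \<le> i - 1"
      using multiplicity_fact_le[OF prime_p assms(1)] by (meson le_trans mult_le_mono2)
    then have "real (p - 1) * real (multiplicity p i) \<le> real (i - 1)"
      unfolding of_nat_mult[symmetric] of_nat_le_iff .
    then show ?thesis using real_p_minus_1 by (simp add: field_simps)
  qed
  ultimately show ?thesis using ord_of_nat[OF pos(1)] by simp
qed

text \<open>
  Write \<open>bessel \<pi> = 1 + h\<close>. In the binomial expansion of the power the linear term \<open>k * h\<close>
  dominates, because the coefficients of \<open>h\<close> have valuation at least \<open>2 / (p - 1)\<close>, which
  exceeds the bound \<open>1 / (p - 1)\<close> needed for the convergence of the exponential.
\<close>

lemma ord_bessel_power_nth_prime_power:
  assumes pi: "\<pi> ^ (p - 1) = - of_nat p" and k: "k \<ge> 1"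
  shows "ord ((bessel \<pi> ^ k) $ (p ^ j)) \<le> ereal (real (multiplicity p k) + 2 / (real p - 1))"
proof (rule ccontr)
  define n where "n = p ^ j"
  define d where "d = 1 / (real p - 1)"
  define v where "v = real (multiplicity p k)"
  define h where "h = bessel \<pi> - 1"
  have d: "d > 0" using real_p_minus_1 by (simp add: d_def)
  have n: "n \<ge> 1" using prime_gt_0_nat[OF prime_p] by (simp add: n_def)
  assume "\<not> ?thesis"
  then have gt: "ereal (v + 2 * d) < ord ((bessel \<pi> ^ k) $ n)"
    by (simp add: v_def d_def n_def)
  \<comment> \<open>The constant term of \<open>h\<close> is 0, of infinite valuation, so the bound
    for n \<ge> 1 extends to all coefficients.\<close>
  have h_nth: "ereal (2 * d) \<le> ord (h $ l)" for l
    using ord_bessel_nth_ge[OF pi, of l]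
    by (cases "l = 0") (auto simp: h_def d_def bessel_nth ord_zero)
  let ?T = "\<lambda>i. of_nat (k choose i) * (h ^ i) $ n"
  have "(bessel \<pi> ^ k) $ n = (\<Sum>i\<le>k. ?T i)"
  proof -
    have "bessel \<pi> ^ k = (h + 1) ^ k" by (simp add: h_def)
    also have "\<dots> = (\<Sum>i\<le>k. of_nat (k choose i) * h ^ i)" by (simp add: binomial_ring)
    finally show ?thesis by (simp add: fps_sum_nth fps_of_nat[symmetric] del: fps_of_nat)
  qed
  also have "\<dots> = ?T 1 + (\<Sum>i\<in>{2..k}. ?T i)"
  proof -
    have "{..k} = insert 0 (insert 1 {2..k})" using k by auto
    then show ?thesis using n by simp
  qed
  finally have lin: "?T 1 = (bessel \<pi> ^ k) $ n - (\<Sum>i\<in>{2..k}. ?T i)" by simp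
  \<comment> \<open>The i-th term has valuation at least v - (i - 1) d + 2 i d = v + (i + 1) d, and
    i \<ge> 2.\<close>
  have rest: "ereal (v + 3 * d) \<le> ord (\<Sum>i\<in>{2..k}. ?T i)"
  proof (rule ord_sum_ge)
    fix i assume i: "i \<in> {2..k}"
    have "ereal ((v - real (i - 1) * d) + real i * (2 * d)) \<le> ord (?T i)"
      using ord_binomial_ge[of i k] i
      by (intro ord_mult_ge ord_fps_power_ge h_nth) (auto simp: v_def d_def)
    moreover have "v + 3 * d \<le> (v - real (i - 1) * d) + real i * (2 * d)"
    proof -
      have "2 * d \<le> real i * d" using i d by (intro mult_right_mono) auto
      then show ?thesis using i by (simp add: of_nat_diff algebra_simps)
    qed
    ultimately show "ereal (v + 3 * d) \<le> ord (?T i)"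
      by (meson ereal_less_eq(3) order_trans)
  qed
  have "ord (?T 1) = ereal (v + 2 * d)"
  proof -
    have "h $ n = bessel \<pi> $ n" using n by (simp add: h_def)
    then show ?thesis
      using ord_bessel_nth_prime_power[OF pi, of j] ord_of_nat[of k] k
      by (simp add: ord_mult v_def d_def n_def)
  qed
  \<comment> \<open>By assumption the full coefficient has valuation above v + 2d, and so do the
    terms with i \<ge> 2; the linear term, of valuation exactly v + 2d, cannot be their
    difference.\<close>
  moreover have "min (ord ((bessel \<pi> ^ k) $ n)) (ereal (v + 3 * d)) \<le> ord (?T 1)"
    unfolding lin using rest by (intro ord_diff_ge) (auto simp: min.coboundedI2)
  moreover have "ereal (v + 2 * d) < ereal (v + 3 * d)" using d by simp
  ultimately show False using gt by (metis min_less_iff_conj not_less)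
qed

text \<open>For m = k the series is f^k. Along n = p^j its coefficients have bounded valuation,
  whereas the required lower bound tends to infinity since c > 0.\<close>

lemma sym_bessel_unbounded:
  assumes pi: "\<pi> ^ (p - 1) = - of_nat p" and k: "k \<ge> 1" and c: "c > 0"
    and bound: "\<And>n. ereal (c * real n + \<rho>) \<le> ord (a * sym_bessel \<pi> k k $ n)"
  shows "a = 0"
proof (rule ccontr)
  assume "a \<noteq> 0"
  then obtain r where r: "ord a = ereal r" by (rule ord_real)
  define B where "B = r + (real (multiplicity p k) + 2 / (real p - 1))"
  have le: "c * real (p ^ j) + \<rho> \<le> B" for j
  proof -
    have "ereal (c * real (p ^ j) + \<rho>) \<le> ord a + ord ((bessel \<pi> ^ k) $ (p ^ j))"
      using bound[of "p ^ j"] by (simp add: sym_bessel_def ord_mult)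
    also have "\<dots> \<le> ereal r + ereal (real (multiplicity p k) + 2 / (real p - 1))"
      unfolding r by (intro add_left_mono ord_bessel_power_nth_prime_power pi k)
    finally show ?thesis by (simp add: B_def)
  qed
  obtain j where j: "(B - \<rho>) / c < real p ^ j"
    using real_arch_pow[of "real p"] prime_gt_1_nat[OF prime_p] by auto
  then have "B - \<rho> < c * real p ^ j" using c by (simp add: field_simps)
  with le[of j] show False by simp
qed

end

section \<open>The kernel\<close>

lemma zero_in_adjoin: "0 \<in> adjoin K x"
  by (auto simp: adjoin_def is_subfield_def)

text \<open>As \<open>mod_ffact\<close> never vanishes, the family in the definition of the space is
  unique and is recovered by division.\<close>

lemma S_spaceE:
  assumes "F \<in> S_space ord K \<kappa> b' \<epsilon>"
  obtains \<rho> where "\<And>n m. F $ n $ m / mod_ffact \<kappa> m \<in> K"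
    "\<And>n m. ereal (2 * b' * real n + \<epsilon> * real m + \<rho>) \<le> ord (F $ n $ m / mod_ffact \<kappa> m)"
proof -
  from assms obtain A \<rho> where A: "\<forall>n m. A n m \<in> K \<and>
      ord (A n m) \<ge> ereal (2 * b' * real n + \<epsilon> * real m + \<rho>)"
    and F: "F = Abs_fps (\<lambda>n. Abs_fps (\<lambda>m. A n m * mod_ffact \<kappa> m))"
    by (auto simp: S_space_def S_space_level_def)
  have "F $ n $ m / mod_ffact \<kappa> m = A n m" for n m
    by (simp add: F mod_ffact_nonzero)
  with A show thesis by (intro that[of \<rho>]) auto
qed

lemma (in padic_closure) const2_in_S_space:
  assumes "a \<in> K" "0 \<in> K"
  shows "const2 a \<in> S_space ord K \<kappa> b' \<epsilon>"
proof -
  \<comment> \<open>For a = 0 the valuation is infinite and any \<rho> will do.\<close>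
  obtain \<rho> where \<rho>: "ereal \<rho> \<le> ord a"
    by (metis ord_real ord_zero ereal_less_eq(1) order_refl)
  define A where "A n m = (if n = 0 \<and> m = 0 then a else 0)" for n m :: nat
  have "const2 a = Abs_fps (\<lambda>n. Abs_fps (\<lambda>m. A n m * mod_ffact \<kappa> m))"
    by (auto simp: fps_eq_iff const2_def A_def mod_ffact_def)
  moreover have "A n m \<in> K \<and> ord (A n m) \<ge> ereal (2 * b' * real n + \<epsilon> * real m + \<rho>)" for n m
    using assms \<rho> by (auto simp: A_def ord_zero)
  ultimately show ?thesis
    unfolding S_space_def S_space_level_def by blast
qed

text \<open>For \<kappa> = 0 the image of t^0 w^(0) has no raising term, by the exceptional case m =
  k.\<close>

lemma del_const2_0: "del \<pi> 0 (const2 a) = 0"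
  unfolding del_eq_0_iff kernel_recurrence_def by (auto simp: const2_def)

lemma del_0: "del \<pi> \<kappa> 0 = 0"
  unfolding del_eq_0_iff kernel_recurrence_def by simp

text \<open>For \<kappa> = k \<ge> 1 the condition b' > 0 is essential: all coefficients of the
  \<open>sym_bessel \<pi> k m\<close> have valuation at least 0 and m \<le> k, so for b' \<le> 0 the
  formal solution lies in the space and the kernel is nonzero.\<close>

theorem theorem3p1:
  fixes p :: nat
    and ord :: "'a::{alg_closed_field, field_char_0} \<Rightarrow> ereal"
    and \<pi> \<kappa> :: 'a
    and \<Omega> :: "'a set"
    and b b' \<epsilon> :: real
  assumes "padic_closure p ord"
    and "p \<ge> 5"
    and "\<pi> ^ (p - 1) = - of_nat p"
    and "\<Omega> = adjoin (padic_rationals ord) \<pi>"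
    and "(real p - 1) / real p \<ge> b" and "b > 1 / (real p - 1)"
    and "b \<ge> b'"
    and "\<epsilon> = b - 1 / (real p - 1)"
    and "\<kappa> \<in> padic_integers ord"
    and "\<kappa> \<in> \<nat> - {0} \<Longrightarrow> b' > 0"
  shows "H0 ord \<Omega> \<pi> \<kappa> b' \<epsilon> = (if \<kappa> = 0 then const2 ` \<Omega> else {0})"
proof -
  interpret padic_closure p ord by fact
  have zero: "0 \<in> \<Omega>" using assms(4) zero_in_adjoin by simp
  have const2_0: "const2 0 = (0 :: 'a fps fps)" by (simp add: const2_def)
  have "F \<in> (if \<kappa> = 0 then const2 ` \<Omega> else {0})" if F: "F \<in> H0 ord \<Omega> \<pi> \<kappa> b' \<epsilon>" for F
  proof -
    define A where "A n m = F $ n $ m / mod_ffact \<kappa> m" for n m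
    have F_nth: "F $ n $ m = A n m * mod_ffact \<kappa> m" for n m
      by (simp add: A_def mod_ffact_nonzero)
    have rec: "kernel_recurrence \<pi> \<kappa> A"
      using F by (simp add: H0_def del_eq_0_iff A_def[abs_def])
    obtain \<rho> where A: "\<And>n m. A n m \<in> \<Omega>"
      "\<And>n m. ereal (2 * b' * real n + \<epsilon> * real m + \<rho>) \<le> ord (A n m)"
      using S_spaceE[of F ord \<Omega> \<kappa> b' \<epsilon>] F unfolding H0_def A_def by blast
    have F_0: "F = 0" if "\<And>n m. A n m = 0"
      using that by (simp add: fps_eq_iff F_nth)
    show ?thesis
    proof (cases "\<kappa> \<in> \<nat>")
      case False
      then have "\<kappa> \<noteq> of_nat m" for m by auto
      then have "A n m = 0" for n m
        using kernel_recurrence_unique[OF rec] kernel_recurrence_initial[OF rec] by blast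
      then have "F = 0" by (rule F_0)
      then show ?thesis using False by auto
    next
      case True
      then obtain k where k: "\<kappa> = of_nat k" by (auto elim: Nats_cases)
      note sol = kernel_recurrence_of_nat[OF rec[unfolded k]]
      show ?thesis
      proof (cases "k = 0")
        case True
        \<comment> \<open>For k = 0 the formal solution is 1 at m = 0 and 0 elsewhere.\<close>
        have "F $ n $ m = const2 (A 0 0) $ n $ m" for n m
          unfolding F_nth sol[of n m] using True k
          by (auto simp: sym_bessel_def const2_def mod_ffact_def)
        then have "F = const2 (A 0 0)" by (simp add: fps_eq_iff)
        then show ?thesis using A(1) True k by auto
      next
        case False
        then have "2 * b' > 0" using assms(10) k by auto
        \<comment> \<open>With m = k fixed, \<epsilon> k is a constant and is absorbed into
          \<rho>.\<close>
        moreover have "ereal (2 * b' * real n + (\<epsilon> * real k + \<rho>))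
            \<le> ord (A 0 k * sym_bessel \<pi> k k $ n)" for n
          using A(2)[of n k] unfolding sol[of n k] by (simp add: add.assoc)
        ultimately have "A 0 k = 0"
          using False by (intro sym_bessel_unbounded[OF assms(3), of k "2 * b'"]) auto
        then have "A n m = 0" for n m unfolding sol[of n m] by simp
        then have "F = 0" by (rule F_0)
        then show ?thesis using False k by auto
      qed
    qed
  qed
  moreover have "const2 a \<in> H0 ord \<Omega> \<pi> \<kappa> b' \<epsilon>" if "a \<in> \<Omega>" "\<kappa> = 0" for a
    using that zero by (simp add: H0_def const2_in_S_space del_const2_0)
  moreover have "0 \<in> H0 ord \<Omega> \<pi> \<kappa> b' \<epsilon>"
    using const2_in_S_space[OF zero zero] by (simp add: H0_def const2_0 del_0)
  ultimately show ?thesis by (auto simp: subset_iff split: if_splits)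
qed

end
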